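(* For all integers $0\leq k\leq n$, the number of elements of $A_{n,k}(213)$ is the ballot number $$C_{n,k}=\frac{n-k+1}{n+1}\binom{n+k}{k}.$$
   Context: $S_n$ is the set of permutations $\pi=\pi_1\cdots\pi_n$ of $\{1,\ldots,n\}$ (for $n=0$, the single empty permutation). $\mathrm{maxdrop}(\pi)=\max\{i-\pi_i : 1\le i\le n\}$ and $A(n,k)=\{\pi\in S_n : \mathrm{maxdrop}(\pi)\le k\}$ (for $n=0$ the condition is vacuous). A permutation $\pi$ is $213$-avoiding if there are no indices $a<b<c$ with $\pi_b<\pi_a<\pi_c$. $A_{n,k}(213)$ is the set of $213$-avoiding permutations in $A(n,k)$. *)

theory Defs
  imports Complex_Main "HOL-Combinatorics.Permutations"
begin

(* A permutation of {1,...,n} is a function p with "p permutes {1..n}"; it is the identity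
   outside {1..n}, so such functions are in bijection with words p 1 ... p n.
   For n = 0 the only one is the identity, i.e. the empty permutation. *)

definition perms :: "nat \<Rightarrow> (nat \<Rightarrow> nat) set" where
  "perms n = {p. p permutes {1..n}}"

(* The drops i - p i may be negative, hence the integers. Only meaningful for n > 0. *)
definition maxdrop :: "nat \<Rightarrow> (nat \<Rightarrow> nat) \<Rightarrow> int" where
  "maxdrop n p = Max ((\<lambda>i. int i - int (p i)) ` {1..n})"

(* For n = 0 the maximum is over the empty set and the condition is vacuous. *)
definition maxdrop_perms :: "nat \<Rightarrow> nat \<Rightarrow> (nat \<Rightarrow> nat) set" where
  "maxdrop_perms n k = {p \<in> perms n. n > 0 \<longrightarrow> maxdrop n p \<le> int k}"

definition avoids_213 :: "nat \<Rightarrow> (nat \<Rightarrow> nat) \<Rightarrow> bool" where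
  "avoids_213 n p \<longleftrightarrow>
     \<not> (\<exists>a\<in>{1..n}. \<exists>b\<in>{1..n}. \<exists>c\<in>{1..n}. a < b \<and> b < c \<and> p b < p a \<and> p a < p c)"

definition maxdrop_perms_213 :: "nat \<Rightarrow> nat \<Rightarrow> (nat \<Rightarrow> nat) set" where
  "maxdrop_perms_213 n k = {p \<in> maxdrop_perms n k. avoids_213 n p}"

definition ballot :: "nat \<Rightarrow> nat \<Rightarrow> real" where
  "ballot n k = (real n - real k + 1) / (real n + 1) * real ((n + k) choose k)"

end

theory Submission
  imports Defs
begin

text \<open>The entries preceding the maximum of a 213-avoiding permutation increase, so the maximum
  sits at the end of the initial increasing run. Deleting it from position \<open>r\<close> gives a
  213-avoiding permutation of one letter less whose run has length at least \<open>r - 1\<close>, and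
  every such permutation arises. The deletion moves the later entries one place to the left, while
  the earlier ones, being increasing, satisfy \<open>i \<le> p i\<close>; so the bound on the drops goes
  from \<open>k + 1\<close> to \<open>k\<close>. Counting by a lower bound on the length of the run thus
  gives a recurrence of Pascal type, solved by the reflection formula
  \<open>C(n + k - r, k) - C(n + k - r, n + 1)\<close>.\<close>

text \<open>Lengths 0 and 1 impose nothing, and since \<open>p\<close> fixes every number above
  \<open>n\<close>, lengths beyond \<open>n\<close> ask no more than \<open>n\<close> does.\<close>

definition run_perms :: "nat \<Rightarrow> nat \<Rightarrow> nat \<Rightarrow> (nat \<Rightarrow> nat) set" where
  "run_perms n k r = {p \<in> maxdrop_perms_213 n k. strict_mono_on {1..r} p}"

lemma maxdrop_perms_iff:
  "p \<in> maxdrop_perms n k \<longleftrightarrow> p permutes {1..n} \<and> (\<forall>i\<in>{1..n}. i \<le> p i + k)"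
proof (cases "n = 0")
  case False
  then have "maxdrop n p \<le> int k \<longleftrightarrow> (\<forall>i\<in>{1..n}. int i - int (p i) \<le> int k)"
    unfolding maxdrop_def by (subst Max_le_iff) auto
  also have "\<dots> \<longleftrightarrow> (\<forall>i\<in>{1..n}. i \<le> p i + k)"
    by (intro ball_cong) auto
  finally show ?thesis
    using False by (auto simp: maxdrop_perms_def perms_def)
qed (auto simp: maxdrop_perms_def perms_def)

lemma run_perms_iff:
  "p \<in> run_perms n k r \<longleftrightarrow> p permutes {1..n} \<and> (\<forall>i\<in>{1..n}. i \<le> p i + k)
     \<and> avoids_213 n p \<and> strict_mono_on {1..r} p"
  by (auto simp: run_perms_def maxdrop_perms_213_def maxdrop_perms_iff)

lemma avoids_213D:
  assumes "avoids_213 n p" "1 \<le> a" "a < b" "b < c" "c \<le> n" "p b < p a"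
  shows "p c \<le> p a"
proof (rule ccontr)
  assume "\<not> p c \<le> p a"
  moreover have "a \<in> {1..n}" "b \<in> {1..n}" "c \<in> {1..n}"
    using assms by auto
  ultimately show False
    using assms unfolding avoids_213_def by (meson not_le)
qed

lemma finite_run_perms: "finite (run_perms n k r)"
  by (rule finite_subset[OF _ finite_permutations[of "{1..n}"]]) (auto simp: run_perms_iff)

text \<open>The values start at 1 or more and grow by at least 1 at each step. Hence an increasing
  initial run contains no positive drop.\<close>

lemma strict_mono_on_perm_ge:
  fixes p :: "nat \<Rightarrow> nat"
  assumes "p permutes {1..n}" "strict_mono_on {1..r} p" "r \<le> n" "i \<in> {1..r}"
  shows "i \<le> p i"
  using assms(4)
proof (induction i)
  case (Suc i)
  show ?case
  proof (cases "i = 0")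
    case True
    then show ?thesis
      using permutes_in_image[OF assms(1), of 1] assms(3) Suc.prems by auto
  next
    case False
    then have "p i < p (Suc i)"
      using assms(2) Suc.prems by (auto intro: strict_mono_onD)
    then show ?thesis
      using Suc False by auto
  qed
qed auto

lemma id_in_run_perms: "id \<in> run_perms n k r"
  by (auto simp: run_perms_iff permutes_id avoids_213_def strict_mono_on_def)

lemma run_perms_no_drop: "run_perms n 0 r = {id}"
proof -
  have "p = id" if "p \<in> run_perms n 0 r" for p
    using that permutes_natset_ge[of p "{1..n}"] by (auto simp: run_perms_iff)
  then show ?thesis
    using id_in_run_perms by blast
qed

lemma run_perms_full: "run_perms n k n = {id}"
proof -
  have "p = id" if "p \<in> run_perms n k n" for p
    using that permutes_natset_ge[of p "{1..n}"] strict_mono_on_perm_ge[of p n n]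
    by (auto simp: run_perms_iff)
  then show ?thesis
    using id_in_run_perms by blast
qed

text \<open>The recurrence in \<open>r\<close> only reaches down to 1; this supplies the value at
  0.\<close>

lemma run_perms_0: "run_perms n k 0 = run_perms n k 1"
  by (auto simp: run_perms_iff strict_mono_on_def)

text \<open>Insertion acts on positions, as a cycle: a permutation \<open>q\<close> of
  \<open>{1..n}\<close> fixes \<open>Suc n\<close>, so \<open>q \<circ> ins_pos n r\<close> shows
  that value at position \<open>r\<close> and the later entries of \<open>q\<close> one place
  further right.\<close>

definition ins_pos :: "nat \<Rightarrow> nat \<Rightarrow> nat \<Rightarrow> nat" where
  "ins_pos n r i = (if i = r then Suc n else if r < i \<and> i \<le> Suc n then i - 1 else i)"

text \<open>The inverse cycle. It sends \<open>Suc n\<close> to \<open>r\<close>, so if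
  \<open>p r = Suc n\<close> then \<open>p \<circ> del_pos n r\<close> fixes \<open>Suc n\<close>
  and is a word of length \<open>n\<close>.\<close>

definition del_pos :: "nat \<Rightarrow> nat \<Rightarrow> nat \<Rightarrow> nat" where
  "del_pos n r i = (if r \<le> i \<and> i \<le> n then Suc i else if i = Suc n then r else i)"

lemma ins_del_pos:
  assumes "1 \<le> r" "r \<le> Suc n"
  shows "ins_pos n r \<circ> del_pos n r = id" "del_pos n r \<circ> ins_pos n r = id"
  using assms by (auto simp: ins_pos_def del_pos_def fun_eq_iff)

lemma ins_pos_permutes:
  assumes "1 \<le> r" "r \<le> Suc n"
  shows "ins_pos n r permutes {1..Suc n}"
proof (rule bij_imp_permutes)
  have "bij (ins_pos n r)"
    using ins_del_pos[OF assms] by (metis o_bij)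
  moreover have "ins_pos n r ` {1..Suc n} = {1..Suc n}"
  proof (rule card_subset_eq)
    show "card (ins_pos n r ` {1..Suc n}) = card {1..Suc n}"
      using \<open>bij (ins_pos n r)\<close> by (intro card_image) (auto simp: bij_def intro: inj_on_subset)
  qed (use assms in \<open>auto simp: ins_pos_def\<close>)
  ultimately show "bij_betw (ins_pos n r) {1..Suc n} {1..Suc n}"
    by (auto simp: bij_betw_def bij_def intro: inj_on_subset)
qed (use assms in \<open>auto simp: ins_pos_def\<close>)

lemma del_pos_permutes:
  assumes "1 \<le> r" "r \<le> Suc n"
  shows "del_pos n r permutes {1..Suc n}"
proof -
  have "inv (ins_pos n r) = del_pos n r"
    using ins_del_pos[OF assms] by (metis inv_unique_comp)
  then show ?thesis
    using permutes_inv[OF ins_pos_permutes[OF assms]] by simp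
qed

text \<open>Moving right costs the later entries one unit of drop, hence \<open>Suc k\<close>. The
  new maximum lengthens the run \<open>r - 1\<close> by one; without that run it could complete a
  213 pattern as the largest entry.\<close>

lemma insert_max_in_run_perms:
  assumes q: "q \<in> run_perms n k (r - 1)" and r: "1 \<le> r" "r \<le> Suc n"
  shows "q \<circ> ins_pos n r \<in> {p \<in> run_perms (Suc n) (Suc k) r. p r = Suc n}"
proof -
  from q have perm: "q permutes {1..n}" and drop: "\<And>i. i \<in> {1..n} \<Longrightarrow> i \<le> q i + k"
    and avoid: "avoids_213 n q" and mono: "strict_mono_on {1..r - 1} q"
    by (auto simp: run_perms_iff)
  define p where "p = q \<circ> ins_pos n r"
  have before: "p i = q i" if "i < r" for i
    using that by (simp add: p_def ins_pos_def)
  have after: "p i = q (i - 1)" if "r < i" "i \<le> Suc n" for i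
    using that by (simp add: p_def ins_pos_def)
  have max: "p r = Suc n"
    using permutes_not_in[OF perm, of "Suc n"] by (simp add: p_def ins_pos_def)
  have "q permutes {1..Suc n}"
    by (rule permutes_subset[OF perm]) auto
  then have p: "p permutes {1..Suc n}"
    unfolding p_def by (intro permutes_compose ins_pos_permutes r)
  have le: "p i \<le> Suc n" if "i \<in> {1..Suc n}" for i
    using permutes_in_image[OF p, of i] that by auto
  have "i \<le> p i + Suc k" if i: "i \<in> {1..Suc n}" for i
  proof -
    consider "i < r" | "i = r" | "r < i" by linarith
    then show ?thesis
    proof cases
      case 1
      then show ?thesis using drop[of i] before i r by force
    next
      case 2
      then show ?thesis using max i by auto
    next
      case 3
      then show ?thesis using drop[of "i - 1"] after i r by force
    qed
  qed
  moreover have "avoids_213 (Suc n) p"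
    unfolding avoids_213_def
  proof (rule notI, elim bexE conjE)
    fix a b c
    assume abc: "a \<in> {1..Suc n}" "b \<in> {1..Suc n}" "c \<in> {1..Suc n}" "a < b" "b < c"
      and bad: "p b < p a" "p a < p c"
    \<comment> \<open>Both positions carry a value below another one, so neither holds the
      maximum.\<close>
    have "a \<noteq> r" "b \<noteq> r"
      using max le bad abc by (metis not_le)+
    \<comment> \<open>If the maximum is the last entry of the pattern, then \<open>a\<close> and
      \<open>b\<close> lie in the increasing run of \<open>q\<close>.\<close>
    have "c \<noteq> r"
    proof
      assume "c = r"
      then have "q a < q b"
        using abc by (intro strict_mono_onD[OF mono]) auto
      then show False
        using bad before abc \<open>c = r\<close> by auto
    qed
    \<comment> \<open>Closing the gap at \<open>r\<close> keeps the order of the other positions, so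
      the pattern would already occur in \<open>q\<close>.\<close>
    define d where "d = (\<lambda>i. if i < r then i else i - 1 :: nat)"
    have d: "p i = q (d i)" if "i \<noteq> r" "i \<in> {1..Suc n}" for i
      using that before after by (auto simp: d_def)
    have "1 \<le> d a" "d a < d b" "d b < d c" "d c \<le> n"
      using abc r \<open>a \<noteq> r\<close> \<open>b \<noteq> r\<close> \<open>c \<noteq> r\<close> by (auto simp: d_def)
    then show False
      using avoids_213D[OF avoid, of "d a" "d b" "d c"] bad d abc \<open>a \<noteq> r\<close> \<open>b \<noteq> r\<close> \<open>c \<noteq> r\<close>
      by (metis not_le)
  qed
  moreover have "strict_mono_on {1..r} p"
  proof (rule strict_mono_onI)
    fix i j assume ij: "i \<in> {1..r}" "j \<in> {1..r}" "i < j"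
    show "p i < p j"
    proof (cases "j = r")
      case True
      have "p i \<noteq> p r"
        using permutes_inj[OF p] ij True by (metis injD less_irrefl)
      then show ?thesis
        using le[of i] max ij r True by auto
    next
      case False
      then show ?thesis
        using ij before strict_mono_onD[OF mono, of i j] by auto
    qed
  qed
  ultimately show ?thesis
    using p max unfolding p_def by (auto simp: run_perms_iff)
qed

text \<open>Entries after the maximum move left, which lowers \<open>Suc k\<close> to
  \<open>k\<close>. Those before it stay in place, but they form an increasing run and so satisfy
  any bound.\<close>

lemma delete_max_in_run_perms:
  assumes p: "p \<in> run_perms (Suc n) (Suc k) r" and max: "p r = Suc n"
    and r: "1 \<le> r" "r \<le> Suc n"
  shows "p \<circ> del_pos n r \<in> run_perms n k (r - 1)"
proof -
  from p have perm: "p permutes {1..Suc n}"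
    and drop: "\<And>i. i \<in> {1..Suc n} \<Longrightarrow> i \<le> p i + Suc k"
    and avoid: "avoids_213 (Suc n) p" and mono: "strict_mono_on {1..r} p"
    by (auto simp: run_perms_iff)
  define q where "q = p \<circ> del_pos n r"
  have before: "q i = p i" if "i < r" for i
    using that r by (simp add: q_def del_pos_def)
  have after: "q i = p (Suc i)" if "r \<le> i" "i \<le> n" for i
    using that by (simp add: q_def del_pos_def)
  have q': "q permutes {1..Suc n}"
    unfolding q_def by (intro permutes_compose del_pos_permutes perm r)
  have fix_max: "q (Suc n) = Suc n"
    using max r by (simp add: q_def del_pos_def)
  have q: "q permutes {1..n}"
    by (rule permutes_superset[OF q']) (use fix_max in \<open>auto simp: le_Suc_eq\<close>)
  have mono': "strict_mono_on {1..r - 1} q"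
    using strict_mono_onD[OF mono] before by (intro strict_mono_onI) auto
  have "i \<le> q i + k" if i: "i \<in> {1..n}" for i
  proof (cases "i < r")
    case True
    then show ?thesis
      using strict_mono_on_perm_ge[OF q mono', of i] i r by force
  next
    case False
    then show ?thesis
      using drop[of "Suc i"] after i by force
  qed
  moreover have "avoids_213 n q"
    unfolding avoids_213_def
  proof (rule notI, elim bexE conjE)
    fix a b c
    assume abc: "a \<in> {1..n}" "b \<in> {1..n}" "c \<in> {1..n}" "a < b" "b < c"
      and bad: "q b < q a" "q a < q c"
    \<comment> \<open>On \<open>{1..n}\<close> the map \<open>del_pos n r\<close> is increasing, so
      it carries a pattern of \<open>q\<close> to one of \<open>p\<close>.\<close>
    have "1 \<le> del_pos n r a" "del_pos n r a < del_pos n r b"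
      "del_pos n r b < del_pos n r c" "del_pos n r c \<le> Suc n"
      using abc by (auto simp: del_pos_def)
    then show False
      using avoids_213D[OF avoid] bad unfolding q_def by (metis comp_apply not_le)
  qed
  ultimately show ?thesis
    using q mono' unfolding q_def by (auto simp: run_perms_iff)
qed

lemma card_run_perms_max:
  assumes r: "1 \<le> r" "r \<le> Suc n"
  shows "card {p \<in> run_perms (Suc n) (Suc k) r. p r = Suc n} = card (run_perms n k (r - 1))"
proof -
  have "bij_betw (\<lambda>q. q \<circ> ins_pos n r) (run_perms n k (r - 1))
    {p \<in> run_perms (Suc n) (Suc k) r. p r = Suc n}"
  proof (rule bij_betw_byWitness[where f' = "\<lambda>p. p \<circ> del_pos n r"])
    show "(\<lambda>q. q \<circ> ins_pos n r) ` run_perms n k (r - 1)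
        \<subseteq> {p \<in> run_perms (Suc n) (Suc k) r. p r = Suc n}"
      using insert_max_in_run_perms r by blast
    show "(\<lambda>p. p \<circ> del_pos n r) ` {p \<in> run_perms (Suc n) (Suc k) r. p r = Suc n}
        \<subseteq> run_perms n k (r - 1)"
      using delete_max_in_run_perms r by blast
  qed (simp_all add: comp_assoc ins_del_pos[OF r])
  then show ?thesis
    by (simp add: bij_betw_same_card)
qed

text \<open>A descent right after position \<open>r\<close>, followed by the value \<open>n\<close>
  further right, would be a 213 pattern. So the run can stop only at the maximum.\<close>

lemma run_perms_extend:
  assumes p: "p \<in> run_perms n k r" and r: "1 \<le> r" "r < n" and "p r \<noteq> n"
  shows "p \<in> run_perms n k (Suc r)"
proof -
  from p have perm: "p permutes {1..n}" and avoid: "avoids_213 n p"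
    and mono: "strict_mono_on {1..r} p"
    by (auto simp: run_perms_iff)
  have inj: "p i = p j \<longleftrightarrow> i = j" for i j
    using permutes_inj[OF perm] by (auto dest: injD)
  have le: "p i \<le> n" if "i \<in> {1..n}" for i
    using permutes_in_image[OF perm, of i] that by auto
  obtain m where m: "m \<in> {1..n}" "p m = n"
    using permutes_image[OF perm] r by (metis atLeastAtMost_iff imageE less_imp_le order.refl order.trans)
  have "p r < n"
    using le[of r] r \<open>p r \<noteq> n\<close> by auto
  have "r < m"
  proof (rule ccontr)
    assume "\<not> r < m"
    moreover have "m \<noteq> r"
      using m \<open>p r \<noteq> n\<close> by auto
    ultimately have "p m < p r"
      using m by (intro strict_mono_onD[OF mono]) auto
    then show False
      using m \<open>p r < n\<close> by auto
  qed
  have step: "p r < p (Suc r)"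
  proof (rule ccontr)
    assume "\<not> p r < p (Suc r)"
    then have "p (Suc r) < p r"
      using inj[of r "Suc r"] by auto
    \<comment> \<open>The lower entry of the descent is not \<open>n\<close>, so \<open>m\<close>
      lies strictly beyond \<open>Suc r\<close> and can end the pattern.\<close>
    moreover from this have "Suc r \<noteq> m"
      using m \<open>p r < n\<close> by auto
    ultimately show False
      using avoids_213D[OF avoid, of r "Suc r" m] \<open>r < m\<close> m r \<open>p r < n\<close> by auto
  qed
  have "strict_mono_on {1..Suc r} p"
  proof (rule strict_mono_onI)
    fix i j assume ij: "i \<in> {1..Suc r}" "j \<in> {1..Suc r}" "i < j"
    have *: "p x < p y" if "x \<in> {1..r}" "y \<in> {1..r}" "x < y" for x y
      using mono that by (rule strict_mono_onD)
    show "p i < p j"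
    proof (cases "j = Suc r")
      case True
      then have "i = r \<or> p i < p r"
        using ij *[of i r] by (cases "i = r") auto
      then show ?thesis
        using step True by auto
    next
      case False
      then show ?thesis
        using ij by (intro *) auto
    qed
  qed
  then show ?thesis
    using p by (simp add: run_perms_iff)
qed

text \<open>Split by whether the maximum stands at \<open>r\<close>. If not, the run goes on to
  \<open>Suc r\<close>; conversely, a run reaching \<open>Suc r\<close> has a value above
  \<open>p r\<close> there.\<close>

lemma card_run_perms_rec:
  assumes r: "1 \<le> r" "r \<le> n"
  shows "card (run_perms (Suc n) (Suc k) r)
    = card (run_perms (Suc n) (Suc k) (Suc r)) + card (run_perms n k (r - 1))"
proof -
  let ?M = "{p \<in> run_perms (Suc n) (Suc k) r. p r = Suc n}"
  let ?E = "run_perms (Suc n) (Suc k) (Suc r)"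
  have le: "?E \<subseteq> run_perms (Suc n) (Suc k) r"
    by (auto simp: run_perms_iff strict_mono_on_def)
  then have "run_perms (Suc n) (Suc k) r = ?E \<union> ?M"
    using run_perms_extend[of _ "Suc n" "Suc k" r] r by auto
  moreover have "p r \<noteq> Suc n" if "p \<in> ?E" for p
  proof -
    have "p r < p (Suc r)"
      using that r by (auto simp: run_perms_iff intro: strict_mono_onD)
    moreover have "p (Suc r) \<le> Suc n"
      using that r permutes_in_image[of p "{1..Suc n}" "Suc r"] by (auto simp: run_perms_iff)
    ultimately show ?thesis by simp
  qed
  then have "?E \<inter> ?M = {}"
    by auto
  moreover have "finite ?E" "finite ?M"
    using finite_run_perms by auto
  ultimately have "card (run_perms (Suc n) (Suc k) r) = card ?E + card ?M"
    using card_Un_disjoint[of ?E ?M] by metis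
  then show ?thesis
    using card_run_perms_max[of r n k] r by simp
qed

text \<open>The reflection formula, written as a sum to avoid truncated subtraction. Both binomials
  obey Pascal's rule in step with the recurrence, and the second one makes the formula agree at
  \<open>r = 0\<close> and \<open>r = 1\<close>, as \<open>run_perms_0\<close> demands.\<close>

lemma card_run_perms:
  assumes "k \<le> n" "r \<le> n"
  shows "card (run_perms n k r) + ((n + k - r) choose Suc n) = (n + k - r) choose k"
  using assms
proof (induction k arbitrary: n r)
  case 0
  then show ?case by (simp add: run_perms_no_drop binomial_eq_0)
next
  case (Suc k)
  then obtain m where n: "n = Suc m" and km: "k \<le> m"
    by (cases n) auto
  have pos: "card (run_perms n (Suc k) r) + ((n + Suc k - r) choose Suc n)
      = (n + Suc k - r) choose Suc k" if "r \<le> n" "1 \<le> r" for r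
    using that
  \<comment> \<open>The recurrence obtains \<open>r\<close> from \<open>Suc r\<close>, so the
    induction descends from \<open>r = n\<close>, where only the identity is left.\<close>
  proof (induction r rule: inc_induct)
    case base
    then show ?case
      using Suc.prems by (simp add: run_perms_full binomial_eq_0)
  next
    case (step r)
    \<comment> \<open>Both terms of the recurrence have the same upper index
      \<open>m + Suc k - r\<close>, one below that of the claim, as Pascal's rule needs.\<close>
    have N: "n + Suc k - r = Suc (m + Suc k - r)" "n + Suc k - Suc r = m + Suc k - r"
      "m + k - (r - 1) = m + Suc k - r"
      using step n by auto
    have "card (run_perms m k (r - 1)) + ((m + Suc k - r) choose Suc m) = (m + Suc k - r) choose k"
      using Suc.IH[of m "r - 1"] km step n N by simp
    then show ?case
      using step.IH card_run_perms_rec[of r m k] step n N by simp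
  qed
  show ?case
  proof (cases "r = 0")
    case True
    \<comment> \<open>By Pascal's rule, passing from \<open>r = 1\<close> to \<open>r = 0\<close>
      adds one of these terms to each side of the formula; their equality leaves the count
      unchanged.\<close>
    have "(m + Suc k) choose k = (m + Suc k) choose Suc m"
      by (subst binomial_symmetric) auto
    then show ?thesis
      using pos[of 1] n True by (simp add: run_perms_0)
  next
    case False
    then show ?thesis
      using pos Suc.prems by simp
  qed
qed

theorem proposition1p2:
  fixes n k :: nat
  assumes "k \<le> n"
  shows "real (card (maxdrop_perms_213 n k)) = ballot n k"
proof -
  have "run_perms n k 0 = maxdrop_perms_213 n k"
    by (auto simp: run_perms_def strict_mono_on_def)
  then have "card (maxdrop_perms_213 n k) + ((n + k) choose Suc n) = (n + k) choose k"
    using card_run_perms[of k n 0] assms by simp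
  then have card: "real (card (maxdrop_perms_213 n k))
      = real ((n + k) choose k) - real ((n + k) choose Suc n)"
    by linarith
  \<comment> \<open>Both sides equal \<open>(n + k) * ((n + k - 1) choose n)\<close>. The subtracted
    binomial is thus \<open>k / (n + 1)\<close> times the other, which leaves the factor in
    \<open>ballot\<close>.\<close>
  have "Suc n * ((n + k) choose Suc n) = k * ((n + k) choose k)"
    using binomial_absorb_comp[of "n + k" n] binomial_symmetric[of n "n + k"]
    by (simp add: binomial_absorption del: mult_Suc)
  then have "(real n + 1) * real ((n + k) choose Suc n) = real k * real ((n + k) choose k)"
    by (metis of_nat_Suc of_nat_mult add.commute)
  then show ?thesis
    unfolding card ballot_def by (simp add: field_simps)
qed

end
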